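(* Let $\mathcal{H}$ be a real finite-dimensional Hilbert space with inner product $(\cdot,\cdot)$, let $A$ be a self-adjoint positive definite (SPD) linear operator on $\mathcal{H}$, let $B_0$ and $B_1$ be linear operators on $\mathcal{H}$, and let $\omega>0$. Let $B$ be defined by $$I - BA = I - \omega(B_0+B_1)A.$$ Suppose that 1. $B_1$ is SPD on $\mathcal{H}$; 2. $B_0$ is symmetric (self-adjoint) and non-negative on $\mathcal{H}$. Then $B$ is self-adjoint and positive definite on $\mathcal{H}$.
   Context: Self-adjointness is with respect to $(\cdot,\cdot)$. An operator $M$ is positive definite if $(Mu,u)>0$ for all $u\ne0$, and non-negative if $(Mu,u)\ge0$ for all $u$; SPD means self-adjoint and positive definite. $I$ is the identity operator. *)

theory Defs
  imports "HOL-Analysis.Analysis"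
begin

text \<open>
  Operators are linear maps, so linearity is part of self-adjointness. The predicates are stated
  over \<^class>\<open>real_inner\<close>, as \<^class>\<open>euclidean_space\<close> would exclude the zero space.
\<close>

definition self_adjoint :: "('a::real_inner \<Rightarrow> 'a) \<Rightarrow> bool" where
  "self_adjoint M \<longleftrightarrow> linear M \<and> (\<forall>u v. M u \<bullet> v = u \<bullet> M v)"

definition positive_definite :: "('a::real_inner \<Rightarrow> 'a) \<Rightarrow> bool" where
  "positive_definite M \<longleftrightarrow> (\<forall>u. u \<noteq> 0 \<longrightarrow> M u \<bullet> u > 0)"

definition non_negative :: "('a::real_inner \<Rightarrow> 'a) \<Rightarrow> bool" where
  "non_negative M \<longleftrightarrow> (\<forall>u. M u \<bullet> u \<ge> 0)"

definition SPD :: "('a::real_inner \<Rightarrow> 'a) \<Rightarrow> bool" where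
  "SPD M \<longleftrightarrow> self_adjoint M \<and> positive_definite M"

end

theory Submission
  imports Defs
begin

text \<open>
  Comparing the two expressions for the error operator gives
  \<open>B (A u) = \<omega> (B0 (A u) + B1 (A u))\<close>, which determines \<open>B\<close> on the range of \<open>A\<close> only. Positive
  definiteness makes \<open>A\<close> injective, and in finite dimension an injective linear operator is onto, so
  in fact \<open>B = \<omega> (B0 + B1)\<close> everywhere. Even the linearity of \<open>B\<close> is a consequence of this identity.
  Self-adjointness and positivity then pass from \<open>B0\<close> and \<open>B1\<close> to \<open>B\<close>, because self-adjoint
  operators form a vector space, and adding a non-negative form to a positive definite one, or
  scaling by \<open>\<omega> > 0\<close>, keeps it positive definite.
\<close>

text \<open>
  Finite dimension is a property of the carrier here and not of its type class, so the
  rank argument is made available by choosing a finite basis inside the proof.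
\<close>

lemma linear_inj_imp_surj_finite_span:
  fixes f :: "'a::real_vector \<Rightarrow> 'a" and S :: "'a set"
  assumes fin: "finite S" and span_S: "span S = UNIV"
    and lin: "linear f" and inj: "inj f"
  shows "surj f"
proof -
  obtain Bs where Bs: "Bs \<subseteq> S" "independent Bs" "S \<subseteq> span Bs"
    using real_vector.maximal_independent_subset[of S] by blast
  have "span Bs = UNIV"
    using span_minimal[OF Bs(3) subspace_span] span_S by auto
  then interpret finite_dimensional_vector_space "scaleR :: real \<Rightarrow> 'a \<Rightarrow> 'a" Bs
    using Bs finite_subset[OF Bs(1) fin]
    by unfold_locales (auto simp: dependent_raw_def span_raw_def)
  show ?thesis
    using linear_inj_imp_surj lin inj by (simp add: linear_def)
qed

lemma positive_definite_imp_inj: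
  assumes lin: "linear M" and pos: "positive_definite M"
  shows "inj M"
  unfolding linear_injective_0[OF lin]
  using pos by (metis inner_zero_left less_irrefl positive_definite_def)

lemma self_adjoint_add:
  assumes "self_adjoint M" and "self_adjoint N"
  shows "self_adjoint (\<lambda>u. M u + N u)"
  using assms unfolding self_adjoint_def
  by (auto intro: linear_compose_add simp: inner_add_left inner_add_right)

lemma self_adjoint_scaleR:
  assumes "self_adjoint M"
  shows "self_adjoint (\<lambda>u. c *\<^sub>R M u)"
  using assms unfolding self_adjoint_def
  by (auto intro: linear_compose_scale_right)

lemma positive_definite_add_non_negative:
  assumes "non_negative M" and "positive_definite N"
  shows "positive_definite (\<lambda>u. M u + N u)"
  using assms unfolding non_negative_def positive_definite_def
  by (auto simp: inner_add_left intro: add_nonneg_pos)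

lemma positive_definite_scaleR:
  assumes "c > 0" and "positive_definite M"
  shows "positive_definite (\<lambda>u. c *\<^sub>R M u)"
  using assms unfolding positive_definite_def by simp

theorem lemma4p1:
  fixes A B B0 B1 :: "'h::real_inner \<Rightarrow> 'h" and \<omega> :: real
  assumes finite_dim: "\<exists>S :: 'h set. finite S \<and> span S = UNIV"
    and linear_A: "linear A" and linear_B0: "linear B0" and linear_B1: "linear B1"
    and SPD_A: "SPD A"
    and omega_pos: "\<omega> > 0"
    and B_eq: "(\<lambda>u. id u - (B \<circ> A) u) = (\<lambda>u. id u - \<omega> *\<^sub>R (B0 (A u) + B1 (A u)))"
    and SPD_B1: "SPD B1"
    and B0_sym: "self_adjoint B0" and B0_nonneg: "non_negative B0"
  shows "self_adjoint B \<and> positive_definite B"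
proof -
  have "inj A"
    using positive_definite_imp_inj linear_A SPD_A by (auto simp: SPD_def)
  then have surj_A: "surj A"
    using finite_dim linear_A linear_inj_imp_surj_finite_span by blast
  have B_on_range: "B (A u) = \<omega> *\<^sub>R (B0 (A u) + B1 (A u))" for u
    using fun_cong[OF B_eq, of u] by simp
  have B_sum: "B = (\<lambda>v. \<omega> *\<^sub>R (B0 v + B1 v))"
  proof
    fix v
    obtain u where "v = A u" using surj_A by (rule surjE)
    then show "B v = \<omega> *\<^sub>R (B0 v + B1 v)" by (simp only: B_on_range)
  qed
  have "self_adjoint B"
    unfolding B_sum using B0_sym SPD_B1
    by (intro self_adjoint_scaleR self_adjoint_add) (auto simp: SPD_def)
  moreover have "positive_definite B"
    unfolding B_sum using omega_pos B0_nonneg SPD_B1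
    by (intro positive_definite_scaleR positive_definite_add_non_negative) (auto simp: SPD_def)
  ultimately show ?thesis ..
qed

end
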